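(* Let $N\in\mathbb{N}$, $\mu\ge 0$, $\kappa>0$, and let $(\rho_{i,j},(\rho u)_{i,j},(\rho v)_{i,j})_{i,j=1,\dots,N}$, with $\rho_{i,j}>0$, be a solution of the semidiscrete two-dimensional Navier-Stokes-Korteweg scheme with periodic boundary conditions given in the context, with numerical dissipation parameter $\lambda=\frac12\max_{i,j}\{|\mathbf{u}_{i,j}|+\sqrt{p'(\rho_{i,j})}\}$, where $\mathbf{u}_{i,j}=(u_{i,j},v_{i,j})^T$. Then the scheme dissipates the total discrete energy $$E_{\mathrm{NSK}}[\rho,\rho\mathbf{u}]=\frac1{N^2}\sum_{i,j=1}^N E_{i,j},\qquad E_{i,j}=\frac12\rho_{i,j}|\mathbf{u}_{i,j}|^2+P(\rho_{i,j})+\frac{\kappa}{2}|\nabla^+\rho_{i,j}|^2 .$$ In particular, the inequality $$\frac{d}{dt}E_{\mathrm{NSK}}[\rho,\rho\mathbf{u}]\le-\mu\sum_{i,j=1}^N\left(|\nabla^+u_{i,j}|^2+|\nabla^+v_{i,j}|^2\right)-\kappa\sum_{i,j=1}^N\lambda h(\Delta_h\rho_{i,j})^2\le0$$ holds.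
   Context: Grid and operators: $h=1/N$, square cells on the two-dimensional torus. Grid functions $\phi=(\phi_{i,j})$ are periodic: $\phi_{i+kN,j+lN}=\phi_{i,j}$ for all integers $k,l$. Define $$\nabla^c_x\phi_{i,j}=\frac{\phi_{i+1,j}-\phi_{i-1,j}}{2h},\quad \nabla^c_y\phi_{i,j}=\frac{\phi_{i,j+1}-\phi_{i,j-1}}{2h},$$ $$\nabla^\pm_x\phi_{i,j}=\pm\frac{\phi_{i\pm1,j}-\phi_{i,j}}{h},\quad \nabla^\pm_y\phi_{i,j}=\pm\frac{\phi_{i,j\pm1}-\phi_{i,j}}{h},\quad \nabla^+\phi_{i,j}=(\nabla^+_x\phi_{i,j},\nabla^+_y\phi_{i,j})^T,$$ $$\Delta_h\phi_{i,j}=\frac{\phi_{i+1,j}-2\phi_{i,j}+\phi_{i-1,j}}{h^2}+\frac{\phi_{i,j+1}-2\phi_{i,j}+\phi_{i,j-1}}{h^2}.$$ $|\cdot|$ is the Euclidean norm. Products of grid functions are pointwise, e.g. $(\rho u)_{i,j}=\rho_{i,j}u_{i,j}$, $(\rho uv)_{i,j}=\rho_{i,j}u_{i,j}v_{i,j}$. Data: $p$ is a continuously differentiable, strictly monotone pressure function on $(0,\infty)$ such that the first order part of the system is strictly hyperbolic (i.e. $p'>0$); $P$ is any potential energy, i.e. any function on $(0,\infty)$ with $P'(\rho)\rho-P(\rho)=p(\rho)$ (such $P$ is convex); $\mu\ge0$ is the constant viscosity and $\kappa>0$ the constant capillarity coefficient. Scheme (the unknowns are the functions of time $\rho_{i,j}>0$,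 $(\rho u)_{i,j}$, $(\rho v)_{i,j}$): $$-\frac{d}{dt}\rho_{i,j}=\nabla^c_x(\rho u)_{i,j}+\nabla^c_y(\rho v)_{i,j}-\lambda h\,\Delta_h\rho_{i,j},$$ $$\begin{aligned}-\frac{d}{dt}(\rho u)_{i,j}=&\ \nabla^c_x(\rho u^2)_{i,j}+\nabla^c_y(\rho uv)_{i,j}+\nabla^c_x p(\rho_{i,j})-\mu\Delta_h u_{i,j}-\lambda h\,\Delta_h(\rho u)_{i,j}\\&-\kappa\Big[\nabla^-_x\frac{\rho_{i,j}\Delta_h\rho_{i+1,j}+\rho_{i+1,j}\Delta_h\rho_{i,j}}{2}-\frac12\nabla^-_x(\nabla^+_x\rho_{i,j})^2\\&\qquad+\frac12\nabla^-_x\big(\nabla^-_y\rho_{i+1,j}\,\nabla^-_y\rho_{i,j}\big)-\nabla^-_y\big(\nabla^c_x\rho_{i,j}\,\nabla^+_y\rho_{i,j}\big)\Big],\end{aligned}$$ $$\begin{aligned}-\frac{d}{dt}(\rho v)_{i,j}=&\ \nabla^c_y(\rho v^2)_{i,j}+\nabla^c_x(\rho uv)_{i,j}+\nabla^c_y p(\rho_{i,j})-\mu\Delta_h v_{i,j}-\lambda h\,\Delta_h(\rho v)_{i,j}\\&-\kappa\Big[\nabla^-_y\frac{\rho_{i,j}\Delta_h\rho_{i,j+1}+\rho_{i,j+1}\Delta_h\rho_{i,j}}{2}-\frac12\nabla^-_y(\nabla^+_y\rho_{i,j})^2\\&\qquad+\frac12\nabla^-_y\big(\nabla^-_x\rho_{i,j+1}\,\nabla^-_x\rho_{i,j}\big)-\nabla^-_x\big(\nabla^c_y\rho_{i,j}\,\nabla^+_x\rho_{i,j}\big)\Big],\end{aligned}$$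 where $\lambda$ is the same for all $(i,j)$.
   Formalization: Both sums on the right-hand side of the dissipation inequality carry the factor 1/N² (as in the definition of E_NSK); without it the inequality fails, e.g. for N=2, p(r)=r, μ=1, ρ=1, v=0, u=(-1)^i at the initial time. *)

theory Defs
  imports "HOL-Analysis.Analysis"
begin

(* A grid function on the torus is an N-periodic function on all of Z x Z,
   so that shifted indices need no reduction modulo N. *)
type_synonym grid = "int \<Rightarrow> int \<Rightarrow> real"

definition periodic_grid :: "nat \<Rightarrow> grid \<Rightarrow> bool" where
  "periodic_grid N \<phi> \<longleftrightarrow>
     (\<forall>i j k l. \<phi> (i + k * int N) (j + l * int N) = \<phi> i j)"

definition mesh :: "nat \<Rightarrow> real" where
  "mesh N = 1 / real N"

definition cells :: "nat \<Rightarrow> (int \<times> int) set" where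
  "cells N = {1..int N} \<times> {1..int N}"

definition dxc :: "nat \<Rightarrow> grid \<Rightarrow> grid" where
  "dxc N \<phi> i j = (\<phi> (i + 1) j - \<phi> (i - 1) j) / (2 * mesh N)"

definition dyc :: "nat \<Rightarrow> grid \<Rightarrow> grid" where
  "dyc N \<phi> i j = (\<phi> i (j + 1) - \<phi> i (j - 1)) / (2 * mesh N)"

definition dxp :: "nat \<Rightarrow> grid \<Rightarrow> grid" where
  "dxp N \<phi> i j = (\<phi> (i + 1) j - \<phi> i j) / mesh N"

definition dxm :: "nat \<Rightarrow> grid \<Rightarrow> grid" where
  "dxm N \<phi> i j = - ((\<phi> (i - 1) j - \<phi> i j) / mesh N)"

definition dyp :: "nat \<Rightarrow> grid \<Rightarrow> grid" where
  "dyp N \<phi> i j = (\<phi> i (j + 1) - \<phi> i j) / mesh N"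

definition dym :: "nat \<Rightarrow> grid \<Rightarrow> grid" where
  "dym N \<phi> i j = - ((\<phi> i (j - 1) - \<phi> i j) / mesh N)"

(* The norm of real \<times> real is the Euclidean norm. *)
definition gradp :: "nat \<Rightarrow> grid \<Rightarrow> int \<Rightarrow> int \<Rightarrow> real \<times> real" where
  "gradp N \<phi> i j = (dxp N \<phi> i j, dyp N \<phi> i j)"

definition lap :: "nat \<Rightarrow> grid \<Rightarrow> grid" where
  "lap N \<phi> i j =
     (\<phi> (i + 1) j - 2 * \<phi> i j + \<phi> (i - 1) j) / (mesh N)\<^sup>2 +
     (\<phi> i (j + 1) - 2 * \<phi> i j + \<phi> i (j - 1)) / (mesh N)\<^sup>2"

(* The unknowns are the density r and the momenta m = rho u and n = rho v;
   the velocity components u and v are recovered by division. *)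
definition vel :: "grid \<Rightarrow> grid \<Rightarrow> grid" where
  "vel r m i j = m i j / r i j"

definition korteweg_x :: "nat \<Rightarrow> grid \<Rightarrow> grid" where
  "korteweg_x N r i j =
     dxm N (\<lambda>i j. (r i j * lap N r (i + 1) j + r (i + 1) j * lap N r i j) / 2) i j
     - 1 / 2 * dxm N (\<lambda>i j. (dxp N r i j)\<^sup>2) i j
     + 1 / 2 * dxm N (\<lambda>i j. dym N r (i + 1) j * dym N r i j) i j
     - dym N (\<lambda>i j. dxc N r i j * dyp N r i j) i j"

definition korteweg_y :: "nat \<Rightarrow> grid \<Rightarrow> grid" where
  "korteweg_y N r i j =
     dym N (\<lambda>i j. (r i j * lap N r i (j + 1) + r i (j + 1) * lap N r i j) / 2) i j
     - 1 / 2 * dym N (\<lambda>i j. (dyp N r i j)\<^sup>2) i j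
     + 1 / 2 * dym N (\<lambda>i j. dxm N r i (j + 1) * dxm N r i j) i j
     - dxm N (\<lambda>i j. dyc N r i j * dxp N r i j) i j"

(* mass_op, momentum_x_op, momentum_y_op are the spatial parts, equal to
   minus the time derivatives of r, m, n in the scheme. *)
definition mass_op :: "nat \<Rightarrow> real \<Rightarrow> grid \<Rightarrow> grid \<Rightarrow> grid \<Rightarrow> grid" where
  "mass_op N lam r m n i j =
     dxc N m i j + dyc N n i j - lam * mesh N * lap N r i j"

definition momentum_x_op ::
  "nat \<Rightarrow> (real \<Rightarrow> real) \<Rightarrow> real \<Rightarrow> real \<Rightarrow> real \<Rightarrow> grid \<Rightarrow> grid \<Rightarrow> grid \<Rightarrow> grid" where
  "momentum_x_op N p \<mu> \<kappa> lam r m n i j =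
     dxc N (\<lambda>i j. r i j * (vel r m i j)\<^sup>2) i j
     + dyc N (\<lambda>i j. r i j * vel r m i j * vel r n i j) i j
     + dxc N (\<lambda>i j. p (r i j)) i j
     - \<mu> * lap N (vel r m) i j
     - lam * mesh N * lap N m i j
     - \<kappa> * korteweg_x N r i j"

definition momentum_y_op ::
  "nat \<Rightarrow> (real \<Rightarrow> real) \<Rightarrow> real \<Rightarrow> real \<Rightarrow> real \<Rightarrow> grid \<Rightarrow> grid \<Rightarrow> grid \<Rightarrow> grid" where
  "momentum_y_op N p \<mu> \<kappa> lam r m n i j =
     dyc N (\<lambda>i j. r i j * (vel r n i j)\<^sup>2) i j
     + dxc N (\<lambda>i j. r i j * vel r m i j * vel r n i j) i j
     + dyc N (\<lambda>i j. p (r i j)) i j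
     - \<mu> * lap N (vel r n) i j
     - lam * mesh N * lap N n i j
     - \<kappa> * korteweg_y N r i j"

(* The dissipation parameter lam may depend on time, not on the cell.
   Derivatives are taken within the time set I, hence one-sided at
   endpoints of I that belong to I. *)
definition nsk_solution ::
  "nat \<Rightarrow> (real \<Rightarrow> real) \<Rightarrow> real \<Rightarrow> real \<Rightarrow> (real \<Rightarrow> real) \<Rightarrow> real set \<Rightarrow>
   (real \<Rightarrow> grid) \<Rightarrow> (real \<Rightarrow> grid) \<Rightarrow> (real \<Rightarrow> grid) \<Rightarrow> bool" where
  "nsk_solution N p \<mu> \<kappa> lam I \<rho> m n \<longleftrightarrow>
     (\<forall>t\<in>I.
        periodic_grid N (\<rho> t) \<and> periodic_grid N (m t) \<and> periodic_grid N (n t) \<and>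
        (\<forall>i j.
           \<rho> t i j > 0 \<and>
           ((\<lambda>s. \<rho> s i j) has_real_derivative
              - mass_op N (lam t) (\<rho> t) (m t) (n t) i j) (at t within I) \<and>
           ((\<lambda>s. m s i j) has_real_derivative
              - momentum_x_op N p \<mu> \<kappa> (lam t) (\<rho> t) (m t) (n t) i j) (at t within I) \<and>
           ((\<lambda>s. n s i j) has_real_derivative
              - momentum_y_op N p \<mu> \<kappa> (lam t) (\<rho> t) (m t) (n t) i j) (at t within I)))"

definition dissipation_parameter ::
  "nat \<Rightarrow> (real \<Rightarrow> real) \<Rightarrow> grid \<Rightarrow> grid \<Rightarrow> grid \<Rightarrow> real" where
  "dissipation_parameter N p r m n =
     1 / 2 * Max ((\<lambda>(i, j). norm (vel r m i j, vel r n i j) + sqrt (deriv p (r i j))) ` cells N)"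

definition pressure_function :: "(real \<Rightarrow> real) \<Rightarrow> bool" where
  "pressure_function p \<longleftrightarrow>
     p differentiable_on {0<..} \<and> continuous_on {0<..} (deriv p) \<and>
     strict_mono_on {0<..} p \<and> (\<forall>x>0. deriv p x > 0)"

definition potential_energy :: "(real \<Rightarrow> real) \<Rightarrow> (real \<Rightarrow> real) \<Rightarrow> bool" where
  "potential_energy p P \<longleftrightarrow>
     P differentiable_on {0<..} \<and> (\<forall>x>0. deriv P x * x - P x = p x)"

definition cell_energy ::
  "nat \<Rightarrow> (real \<Rightarrow> real) \<Rightarrow> real \<Rightarrow> grid \<Rightarrow> grid \<Rightarrow> grid \<Rightarrow> grid" where
  "cell_energy N P \<kappa> r m n i j =
     1 / 2 * r i j * (norm (vel r m i j, vel r n i j))\<^sup>2 + P (r i j)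
     + \<kappa> / 2 * (norm (gradp N r i j))\<^sup>2"

definition energy ::
  "nat \<Rightarrow> (real \<Rightarrow> real) \<Rightarrow> real \<Rightarrow> grid \<Rightarrow> grid \<Rightarrow> grid \<Rightarrow> real" where
  "energy N P \<kappa> r m n =
     1 / (real N)\<^sup>2 * (\<Sum>(i, j)\<in>cells N. cell_energy N P \<kappa> r m n i j)"

end

theory Submission
  imports Defs
begin

text \<open>
  The energy gradient is \<open>(P'(\<rho>) - |u|\<^sup>2/2 - \<kappa> \<Delta>\<^sub>h \<rho>, u, v)\<close>. Testing the scheme with it, the capillary
  terms cancel because the discrete Korteweg divergence equals
  \<open>\<rho> \<nabla>\<^sup>c \<Delta>\<^sub>h \<rho>\<close> cell by cell, and the viscous and the diffusive capillary terms give the two sums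
  on the right-hand side. What remains is the Lax-Friedrichs discretisation of the Euler equations,
  whose entropy production splits into contributions of the cell edges (Tadmor). On an edge, with jumps
  \<open>[a]\<close> and averages \<open>{a}\<close>, the central flux contributes
  \<open>T {u} + [P'][\<rho>][u]/4 + [\<rho> u] ([u]\<^sup>2 + [v]\<^sup>2)/4\<close>, where \<open>T = [P']{\<rho>} - [p]\<close> satisfies
  \<open>|T| \<le> [P'][\<rho>]/2\<close> by \<open>dp = \<rho> dP'\<close>, and this is absorbed by the numerical diffusion
  \<open>\<lambda> ([P'][\<rho>] + {\<rho>} ([u]\<^sup>2 + [v]\<^sup>2))\<close> as soon as \<open>2 \<lambda> \<ge> |u|\<close> at both ends of the edge.
\<close>

subsection \<open>Sums over the periodic grid\<close>

definition gsum :: "nat \<Rightarrow> grid \<Rightarrow> real" where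
  "gsum N \<phi> = (\<Sum>(i, j)\<in>cells N. \<phi> i j)"

lemma gsum_iterated: "gsum N \<phi> = (\<Sum>i\<in>{1..int N}. \<Sum>j\<in>{1..int N}. \<phi> i j)"
  by (simp add: gsum_def cells_def sum.cartesian_product)

lemma gsum_add: "gsum N (\<lambda>i j. f i j + g i j) = gsum N f + gsum N g"
  by (simp add: gsum_iterated sum.distrib)

lemma gsum_diff: "gsum N (\<lambda>i j. f i j - g i j) = gsum N f - gsum N g"
  by (simp add: gsum_iterated sum_subtractf)

lemma gsum_cmult: "gsum N (\<lambda>i j. c * f i j) = c * gsum N f"
  by (simp add: gsum_iterated sum_distrib_left)

lemma gsum_nonneg: "(\<And>i j. 0 \<le> f i j) \<Longrightarrow> 0 \<le> gsum N f"
  by (simp add: gsum_iterated sum_nonneg)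

lemma gsum_transpose: "gsum N (\<lambda>i j. f j i) = gsum N f"
  unfolding gsum_iterated by (rule sum.swap)

section \<open>Periodicity and reduction to one period\<close>

lemma periodic_gridD:
  "periodic_grid N f \<Longrightarrow> f (i + k * int N) (j + l * int N) = f i j"
  by (simp add: periodic_grid_def)

lemma periodic_grid_transpose: "periodic_grid N f \<Longrightarrow> periodic_grid N (\<lambda>i j. f j i)"
  by (simp add: periodic_grid_def)

lemma periodic_grid_comp: "periodic_grid N f \<Longrightarrow> periodic_grid N (\<lambda>i j. F (f i j))"
  by (simp add: periodic_grid_def)

lemma periodic_grid_comp2:
  "periodic_grid N f \<Longrightarrow> periodic_grid N g \<Longrightarrow> periodic_grid N (\<lambda>i j. F (f i j) (g i j))"
  by (simp add: periodic_grid_def)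

lemma periodic_grid_shift:
  assumes "periodic_grid N f"
  shows "periodic_grid N (\<lambda>i j. f (i + a) (j + b))"
  unfolding periodic_grid_def
proof (intro allI)
  fix i j k l
  show "f (i + k * int N + a) (j + l * int N + b) = f (i + a) (j + b)"
    using periodic_gridD[OF assms, of "i + a" k "j + b" l] by (simp add: algebra_simps)
qed

lemma periodic_grid_vel:
  "periodic_grid N r \<Longrightarrow> periodic_grid N m \<Longrightarrow> periodic_grid N (vel r m)"
  by (simp add: periodic_grid_def vel_def)

lemma periodic_grid_lap:
  assumes "periodic_grid N f"
  shows "periodic_grid N (lap N f)"
  using periodic_grid_shift[OF assms, of 1 0] periodic_grid_shift[OF assms, of "-1" 0]
    periodic_grid_shift[OF assms, of 0 1] periodic_grid_shift[OF assms, of 0 "-1"] assms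
  by (simp add: periodic_grid_def lap_def)

text \<open>The dissipation parameter is a maximum over one period, while the edge estimates use all
  integer indices. One representative cell serves all periodic functions at once, so expressions in
  several grid functions can be transported together.\<close>

lemma periodic_grid_cell:
  assumes "N \<ge> 1"
  obtains i' j' where "(i', j') \<in> cells N" "\<And>g. periodic_grid N g \<Longrightarrow> g i j = g i' j'"
proof -
  define c where "c x = (x - 1) mod int N + 1" for x :: int
  have c: "x = c x + ((x - 1) div int N) * int N" "c x \<in> {1..int N}" for x
  proof -
    have "(x - 1) mod int N + ((x - 1) div int N) * int N = x - 1"
      by (rule mod_div_mult_eq)
    then show "x = c x + ((x - 1) div int N) * int N" by (simp add: c_def)
    have "0 \<le> (x - 1) mod int N" "(x - 1) mod int N < int N"
      using assms by simp_all
    then show "c x \<in> {1..int N}" by (simp add: c_def)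
  qed
  show thesis
  proof (rule that)
    show "(c i, c j) \<in> cells N" using c(2) by (simp add: cells_def)
    show "g i j = g (c i) (c j)" if "periodic_grid N g" for g
      using periodic_gridD[OF that, of "c i" "(i - 1) div int N" "c j" "(j - 1) div int N"]
      by (simp flip: c(1))
  qed
qed

lemma gsum_shift_x:
  assumes "periodic_grid N f"
  shows "gsum N (\<lambda>i j. f (i + 1) j) = gsum N f"
proof (cases "N = 0")
  case False
  define g where "g i = (\<Sum>j\<in>{1..int N}. f i j)" for i
  \<comment> \<open>Shifting the summation window drops column 1 and picks up column
    \<open>N + 1\<close>; periodicity identifies the two.\<close>
  have per: "g (1 + int N) = g 1"
    using periodic_gridD[OF assms, of 1 1 _ 0] by (simp add: g_def)
  have "(\<Sum>i\<in>{1..int N}. g (i + 1)) = sum g {2..int N + 1}"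
    by (rule sum.reindex_bij_witness[of _ "\<lambda>i. i - 1" "\<lambda>i. i + 1"]) auto
  also have "{2..int N + 1} = insert (1 + int N) {2..int N}"
    using False by auto
  also have "sum g \<dots> = g (1 + int N) + sum g {2..int N}"
    by (rule sum.insert) auto
  also have "\<dots> = sum g (insert 1 {2..int N})"
    using per by simp
  also have "insert 1 {2..int N} = {1..int N}"
    using False by auto
  finally show ?thesis by (simp add: gsum_iterated g_def)
qed (simp add: gsum_iterated)

subsection \<open>Summation by parts\<close>

text \<open>Splitting off one direction lets every statement about y follow from its x version:
  exchange the indices of the grid functions and apply \<open>gsum_transpose\<close>.\<close>

definition lapx :: "nat \<Rightarrow> grid \<Rightarrow> grid" where
  "lapx N \<phi> i j = (\<phi> (i + 1) j - 2 * \<phi> i j + \<phi> (i - 1) j) / (mesh N)\<^sup>2"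

lemma lap_eq_lapx: "lap N \<phi> i j = lapx N \<phi> i j + lapx N (\<lambda>i j. \<phi> j i) j i"
  by (simp add: lap_def lapx_def)

lemma dyc_eq_dxc: "dyc N \<phi> i j = dxc N (\<lambda>i j. \<phi> j i) j i"
  by (simp add: dyc_def dxc_def)

lemma dyp_eq_dxp: "dyp N \<phi> i j = dxp N (\<lambda>i j. \<phi> j i) j i"
  by (simp add: dyp_def dxp_def)

lemma gsum_shift_prod:
  assumes "periodic_grid N a" "periodic_grid N b"
  shows "gsum N (\<lambda>i j. a i j * b (i - 1) j) = gsum N (\<lambda>i j. a (i + 1) j * b i j)"
    and "gsum N (\<lambda>i j. a (i + 1) j * b (i + 1) j) = gsum N (\<lambda>i j. a i j * b i j)"
proof -
  have "periodic_grid N (\<lambda>i j. a i j * b (i - 1) j)"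
    using periodic_grid_comp2[OF assms(1) periodic_grid_shift[OF assms(2), of "-1" 0], of "(*)"]
    by simp
  from gsum_shift_x[OF this]
  show "gsum N (\<lambda>i j. a i j * b (i - 1) j) = gsum N (\<lambda>i j. a (i + 1) j * b i j)"
    by simp
  show "gsum N (\<lambda>i j. a (i + 1) j * b (i + 1) j) = gsum N (\<lambda>i j. a i j * b i j)"
    using gsum_shift_x[OF periodic_grid_comp2[OF assms, of "(*)"]] .
qed

text \<open>Rewrites a sum over cells as a sum over the edges between cells i and i + 1, pairing the
  jump of the test function with the average of the flux. This is the form on which Tadmor's
  edgewise argument operates.\<close>

lemma gsum_mult_dxc:
  assumes "periodic_grid N a" "periodic_grid N f"
  shows "gsum N (\<lambda>i j. a i j * dxc N f i j) =
    - (1 / mesh N) * gsum N (\<lambda>i j. (a (i + 1) j - a i j) * ((f i j + f (i + 1) j) / 2))"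
proof -
  have "gsum N (\<lambda>i j. a i j * dxc N f i j) =
      gsum N (\<lambda>i j. 1 / (2 * mesh N) * (a i j * f (i + 1) j - a i j * f (i - 1) j))"
    by (simp add: dxc_def right_diff_distrib diff_divide_distrib)
  also have "\<dots> = 1 / (2 * mesh N) *
      (gsum N (\<lambda>i j. a i j * f (i + 1) j) - gsum N (\<lambda>i j. a (i + 1) j * f i j))"
    by (simp only: gsum_cmult gsum_diff gsum_shift_prod(1)[OF assms])
  \<comment> \<open>The sum of \<open>a i j * f i j\<close> and its shifted copy coincide, so they
    can be inserted with opposite signs to complete the product of jump and average.\<close>
  also have "\<dots> = - (1 / mesh N) * (1 / 2 *
      (gsum N (\<lambda>i j. a (i + 1) j * f i j) + gsum N (\<lambda>i j. a (i + 1) j * f (i + 1) j)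
        - gsum N (\<lambda>i j. a i j * f i j) - gsum N (\<lambda>i j. a i j * f (i + 1) j)))"
    by (simp add: gsum_shift_prod(2)[OF assms] diff_divide_distrib algebra_simps)
  also have "\<dots> = - (1 / mesh N) *
      gsum N (\<lambda>i j. 1 / 2 * (a (i + 1) j * f i j + a (i + 1) j * f (i + 1) j
        - a i j * f i j - a i j * f (i + 1) j))"
    by (simp only: gsum_cmult gsum_diff gsum_add)
  finally show ?thesis by (simp add: algebra_simps add_divide_distrib diff_divide_distrib)
qed

lemma gsum_dxc_by_parts:
  assumes "periodic_grid N a" "periodic_grid N f"
  shows "gsum N (\<lambda>i j. a i j * dxc N f i j) = - gsum N (\<lambda>i j. f i j * dxc N a i j)"
proof -
  \<comment> \<open>The right-hand side is antisymmetric in \<open>c\<close> and \<open>d\<close>,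
    so two instances with exchanged arguments give the claim.\<close>
  have "gsum N (\<lambda>i j. c i j * dxc N d i j) = 1 / (2 * mesh N) *
      (gsum N (\<lambda>i j. c i j * d (i + 1) j) - gsum N (\<lambda>i j. d i j * c (i + 1) j))"
    if "periodic_grid N c" "periodic_grid N d" for c d
  proof -
    have "gsum N (\<lambda>i j. c i j * dxc N d i j) =
        gsum N (\<lambda>i j. 1 / (2 * mesh N) * (c i j * d (i + 1) j - c i j * d (i - 1) j))"
      by (simp add: dxc_def right_diff_distrib diff_divide_distrib)
    also have "\<dots> = 1 / (2 * mesh N) *
        (gsum N (\<lambda>i j. c i j * d (i + 1) j) - gsum N (\<lambda>i j. c (i + 1) j * d i j))"
      by (simp only: gsum_cmult gsum_diff gsum_shift_prod(1)[OF that])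
    finally show ?thesis by (simp add: mult.commute)
  qed
  from this[OF assms] this[OF assms(2,1)] show ?thesis by (simp add: algebra_simps)
qed

lemma gsum_mult_lapx:
  assumes "periodic_grid N a" "periodic_grid N f"
  shows "gsum N (\<lambda>i j. a i j * lapx N f i j) = - gsum N (\<lambda>i j. dxp N a i j * dxp N f i j)"
proof -
  have "gsum N (\<lambda>i j. a i j * lapx N f i j) = gsum N (\<lambda>i j. 1 / (mesh N)\<^sup>2 *
      (a i j * f (i + 1) j - 2 * (a i j * f i j) + a i j * f (i - 1) j))"
    by (simp add: lapx_def algebra_simps flip: add_divide_distrib diff_divide_distrib)
  also have "\<dots> = 1 / (mesh N)\<^sup>2 * (gsum N (\<lambda>i j. a i j * f (i + 1) j)
      - 2 * gsum N (\<lambda>i j. a i j * f i j) + gsum N (\<lambda>i j. a (i + 1) j * f i j))"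
    by (simp only: gsum_cmult gsum_diff gsum_add gsum_shift_prod(1)[OF assms])
  \<comment> \<open>Shifting one of the two copies of the diagonal sum yields the four terms of a
    product of jumps.\<close>
  also have "\<dots> = - (1 / (mesh N)\<^sup>2 *
      (gsum N (\<lambda>i j. a (i + 1) j * f (i + 1) j) - gsum N (\<lambda>i j. a (i + 1) j * f i j)
        - gsum N (\<lambda>i j. a i j * f (i + 1) j) + gsum N (\<lambda>i j. a i j * f i j)))"
    by (simp add: gsum_shift_prod(2)[OF assms] algebra_simps)
  also have "\<dots> = - gsum N (\<lambda>i j. 1 / (mesh N)\<^sup>2 *
      (a (i + 1) j * f (i + 1) j - a (i + 1) j * f i j - a i j * f (i + 1) j + a i j * f i j))"
    by (simp only: gsum_cmult gsum_diff gsum_add)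
  finally show ?thesis
    by (simp add: dxp_def power2_eq_square algebra_simps add_divide_distrib diff_divide_distrib)
qed

lemma gsum_dyc_by_parts:
  assumes "periodic_grid N a" "periodic_grid N f"
  shows "gsum N (\<lambda>i j. a i j * dyc N f i j) = - gsum N (\<lambda>i j. f i j * dyc N a i j)"
proof -
  note t = periodic_grid_transpose
  show ?thesis
    using gsum_dxc_by_parts[OF t[OF assms(1)] t[OF assms(2)]]
      gsum_transpose[of N "\<lambda>i j. a i j * dyc N f i j"]
      gsum_transpose[of N "\<lambda>i j. f i j * dyc N a i j"]
    by (simp add: dyc_eq_dxc)
qed

lemma gsum_mult_lap:
  assumes "periodic_grid N a" "periodic_grid N f"
  shows "gsum N (\<lambda>i j. a i j * lap N f i j) =
    - gsum N (\<lambda>i j. dxp N a i j * dxp N f i j + dyp N a i j * dyp N f i j)"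
proof -
  note t = periodic_grid_transpose
  have "gsum N (\<lambda>i j. a i j * lapx N (\<lambda>i j. f j i) j i) =
      - gsum N (\<lambda>i j. dyp N a i j * dyp N f i j)"
    using gsum_mult_lapx[OF t[OF assms(1)] t[OF assms(2)]]
      gsum_transpose[of N "\<lambda>i j. a i j * lapx N (\<lambda>i j. f j i) j i"]
      gsum_transpose[of N "\<lambda>i j. dyp N a i j * dyp N f i j"]
    by (simp add: dyp_eq_dxp)
  then show ?thesis
    by (simp add: lap_eq_lapx distrib_left gsum_add gsum_mult_lapx[OF assms])
qed

subsection \<open>The Korteweg terms\<close>

text \<open>The first term of the divergence equals \<open>r * dxc (lap r) + lap r * dxc r\<close>.
  The squared difference contributes minus \<open>dxc r\<close> times the second x difference, by a
  difference of squares. In the last two terms the discrete product rule cancels the mixed products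
  and leaves minus \<open>dxc r\<close> times the second y difference.\<close>

lemma korteweg_x_eq: "korteweg_x N r i j = r i j * dxc N (lap N r) i j"
proof -
  \<comment> \<open>With the inverse mesh width as an atom the claim is a polynomial identity,
    without division by the mesh width.\<close>
  define e where "e = 1 / mesh N"
  have e: "x / mesh N = x * e" "x / (2 * mesh N) = x * e / 2" "x / (mesh N)\<^sup>2 = x * (e * e)" for x
    by (simp_all add: e_def power2_eq_square)
  show ?thesis
    unfolding korteweg_x_def dxm_def dym_def dxp_def dyp_def dxc_def lap_def e
    by (simp add: add_divide_distrib diff_divide_distrib)
      (simp add: field_simps power2_eq_square)
qed

lemma korteweg_y_eq: "korteweg_y N r i j = r i j * dyc N (lap N r) i j"
proof -
  have "korteweg_y N r i j = korteweg_x N (\<lambda>i j. r j i) j i"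
    by (simp add: korteweg_y_def korteweg_x_def dxm_def dym_def dxp_def dyp_def dxc_def dyc_def
        lap_def add.commute)
  moreover have "lap N (\<lambda>i j. r j i) = (\<lambda>i j. lap N r j i)"
    by (intro ext) (simp add: lap_def)
  ultimately show ?thesis
    by (simp add: korteweg_x_eq dyc_eq_dxc)
qed

subsection \<open>Entropy production of the Lax-Friedrichs flux\<close>

text \<open>Error bound of the trapezoidal rule for the integral of rho dq, whose value is the jump
  of \<open>p\<close>. It also forces \<open>q\<close> to be nondecreasing, since the right-hand
  side dominates an absolute value.\<close>

definition trapezoidal_pair :: "(real \<Rightarrow> real) \<Rightarrow> (real \<Rightarrow> real) \<Rightarrow> bool" where
  "trapezoidal_pair p q \<longleftrightarrow> (\<forall>a>0. \<forall>b>0.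
     \<bar>(q b - q a) * ((a + b) / 2) - (p b - p a)\<bar> \<le> (b - a) * (q b - q a) / 2)"

section \<open>The trapezoidal bound for the pressure and the derivative of the potential\<close>

lemma deriv_within_pos:
  fixes f :: "real \<Rightarrow> real"
  assumes "f differentiable_on {0<..}" "x > 0"
  shows "(f has_real_derivative deriv f x) (at x)"
proof -
  have "f differentiable (at x)"
    using assms by (metis at_within_open differentiable_on_def greaterThan_iff open_greaterThan)
  then show ?thesis
    using DERIV_deriv_iff_real_differentiable by blast
qed

lemma trapezoidal_pair_deriv_potential:
  assumes "pressure_function p" "potential_energy p P"
  shows "trapezoidal_pair p (deriv P)"
proof -
  let ?q = "deriv P"
  have Dp: "(p has_real_derivative deriv p x) (at x)" if "x > 0" for x
    using assms(1) that by (intro deriv_within_pos) (simp_all add: pressure_function_def)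
  have DP: "(P has_real_derivative ?q x) (at x)" if "x > 0" for x
    using assms(2) that by (intro deriv_within_pos) (simp_all add: potential_energy_def)
  \<comment> \<open>\<open>P\<close> is only assumed differentiable once; solving the defining
    relation for its derivative shows that this derivative is differentiable too, and yields dp = x
    dq.\<close>
  have q_eq: "?q x = (P x + p x) / x" if "x > 0" for x
  proof -
    have "?q x * x - P x = p x"
      using assms(2) that by (simp add: potential_energy_def)
    then show ?thesis using that by (simp add: field_simps)
  qed
  have Dq: "(?q has_real_derivative deriv p x / x) (at x)" if "x > 0" for x
  proof (rule has_field_derivative_transform_within_open[where S = "{0<..}"])
    have "((\<lambda>x. (P x + p x) / x) has_real_derivative
        ((?q x + deriv p x) * x - (P x + p x) * 1) / (x * x)) (at x)"
      by (rule derivative_intros DP Dp that)+ (use that in simp)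
    moreover have "((?q x + deriv p x) * x - (P x + p x) * 1) / (x * x) = deriv p x / x"
      using that q_eq[OF that] by (simp add: field_simps)
    ultimately show "((\<lambda>x. (P x + p x) / x) has_real_derivative deriv p x / x) (at x)"
      by simp
  qed (use that q_eq in auto)
  have p': "deriv p x > 0" if "x > 0" for x
    using assms(1) that by (simp add: pressure_function_def)
  \<comment> \<open>As dp = x dq with a <= x <= b, the jump of \<open>p\<close> lies between these
    bounds. The trapezoidal value is their midpoint, so its error is at most half their
    distance.\<close>
  have main: "a * (?q b - ?q a) \<le> p b - p a \<and> p b - p a \<le> b * (?q b - ?q a)"
    if "0 < a" "a \<le> b" for a b
  proof
    have "p a - a * ?q a \<le> p b - a * ?q b"
    proof (rule DERIV_nonneg_imp_nondecreasing[OF \<open>a \<le> b\<close>])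
      fix x assume x: "a \<le> x" "x \<le> b"
      then have "x > 0" using that by simp
      have "((\<lambda>x. p x - a * ?q x) has_real_derivative deriv p x - a * (deriv p x / x)) (at x)"
        by (intro derivative_intros DERIV_cmult Dp Dq \<open>x > 0\<close>)
      moreover have "0 \<le> deriv p x - a * (deriv p x / x)"
        using x \<open>x > 0\<close> p'[of x] mult_right_mono[of a x "deriv p x"]
        by (simp add: field_simps)
      ultimately show "\<exists>y. ((\<lambda>x. p x - a * ?q x) has_real_derivative y) (at x) \<and> 0 \<le> y" by blast
    qed
    then show "a * (?q b - ?q a) \<le> p b - p a" by (simp add: algebra_simps)
    have "b * ?q a - p a \<le> b * ?q b - p b"
    proof (rule DERIV_nonneg_imp_nondecreasing[OF \<open>a \<le> b\<close>])
      fix x assume x: "a \<le> x" "x \<le> b"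
      then have "x > 0" using that by simp
      have "((\<lambda>x. b * ?q x - p x) has_real_derivative b * (deriv p x / x) - deriv p x) (at x)"
        by (intro derivative_intros DERIV_cmult Dp Dq \<open>x > 0\<close>)
      moreover have "0 \<le> b * (deriv p x / x) - deriv p x"
        using x \<open>x > 0\<close> p'[of x] mult_right_mono[of x b "deriv p x"]
        by (simp add: field_simps)
      ultimately show "\<exists>y. ((\<lambda>x. b * ?q x - p x) has_real_derivative y) (at x) \<and> 0 \<le> y" by blast
    qed
    then show "p b - p a \<le> b * (?q b - ?q a)" by (simp add: algebra_simps)
  qed
  show ?thesis
    unfolding trapezoidal_pair_def
  proof (intro allI impI)
    fix a b :: real assume "0 < a" "0 < b"
    then show "\<bar>(?q b - ?q a) * ((a + b) / 2) - (p b - p a)\<bar> \<le> (b - a) * (?q b - ?q a) / 2"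
      using main[of a b] main[of b a]
      by (cases "a \<le> b") (auto simp: abs_le_iff field_simps)
  qed
qed

text \<open>The subtracted jump of \<open>p u\<close> is that of Tadmor's entropy flux potential,
  the pairing of the entropy variables with the flux minus the entropy flux. It disappears on
  summation over the torus, which is why it may be included here.\<close>

lemma edge_entropy_production:
  fixes a b ua ub va vb qa qb pa pb l :: real
  assumes "a > 0" "b > 0" "\<bar>ua\<bar> \<le> 2 * l" "\<bar>ub\<bar> \<le> 2 * l"
    and T: "\<bar>(qb - qa) * ((a + b) / 2) - (pb - pa)\<bar> \<le> (b - a) * (qb - qa) / 2"
  defines "wa \<equiv> qa - (ua\<^sup>2 + va\<^sup>2) / 2" and "wb \<equiv> qb - (ub\<^sup>2 + vb\<^sup>2) / 2"
  shows "(wb - wa) * ((a * ua + b * ub) / 2) + (ub - ua) * ((a * ua\<^sup>2 + b * ub\<^sup>2) / 2)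
      + (ub - ua) * ((pa + pb) / 2) + (vb - va) * ((a * ua * va + b * ub * vb) / 2)
      - (pb * ub - pa * ua)
    \<le> l * ((wb - wa) * (b - a) + (ub - ua) * (b * ub - a * ua) + (vb - va) * (b * vb - a * va))"
    (is "?L \<le> ?R")
proof -
  let ?T = "(qb - qa) * ((a + b) / 2) - (pb - pa)"
  let ?S = "(b - a) * (qb - qa)"
  let ?V = "(ub - ua)\<^sup>2 + (vb - va)\<^sup>2"
  have L: "?L = ?T * ((ua + ub) / 2) + ?S * ((ub - ua) / 4) + (b * ub - a * ua) / 4 * ?V"
    unfolding wa_def wb_def by (simp add: field_simps power2_eq_square)
  have R: "?R = l * ?S + l * ((a + b) / 2) * ?V"
    unfolding wa_def wb_def by (simp add: field_simps power2_eq_square)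
  have S: "0 \<le> ?S" using T by linarith
  have "?T * ((ua + ub) / 2) \<le> \<bar>?T\<bar> * \<bar>(ua + ub) / 2\<bar>"
    by (metis abs_ge_self abs_mult)
  also have "\<dots> \<le> ?S / 2 * \<bar>(ua + ub) / 2\<bar>"
    using T by (intro mult_right_mono) auto
  also have "\<dots> = ?S * (\<bar>ua + ub\<bar> / 4)"
    by (simp add: abs_divide)
  finally have "?T * ((ua + ub) / 2) + ?S * ((ub - ua) / 4)
      \<le> ?S * (\<bar>ua + ub\<bar> / 4 + (ub - ua) / 4)"
    by (simp only: distrib_left[of ?S] add_le_cancel_right)
  also have "?S * (\<bar>ua + ub\<bar> / 4 + (ub - ua) / 4) \<le> ?S * l"
  proof (rule mult_left_mono[OF _ S])
    \<comment> \<open>The left-hand side is twice the maximum of \<open>ub\<close> and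
      \<open>- ua\<close>.\<close>
    have "\<bar>ua + ub\<bar> + (ub - ua) \<le> 4 * l"
      using assms(3,4) by linarith
    then show "\<bar>ua + ub\<bar> / 4 + (ub - ua) / 4 \<le> l"
      by (simp flip: add_divide_distrib)
  qed
  finally have 1: "?T * ((ua + ub) / 2) + ?S * ((ub - ua) / 4) \<le> l * ?S"
    by (simp add: mult.commute)
  have "b * ub \<le> b * (2 * l)" "a * (- ua) \<le> a * (2 * l)"
    using assms(1-4) by (intro mult_left_mono; linarith)+
  then have "(b * ub - a * ua) / 4 \<le> l * ((a + b) / 2)"
    by (simp add: algebra_simps)
  then have 2: "(b * ub - a * ua) / 4 * ?V \<le> l * ((a + b) / 2) * ?V"
    by (intro mult_right_mono) auto
  show ?thesis unfolding L R using 1 2 by linarith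
qed

lemma flux_dissipation_x:
  assumes N: "N \<ge> 1" and per: "periodic_grid N r" "periodic_grid N u" "periodic_grid N v"
    and pos: "\<And>i j. r i j > 0" and u: "\<And>i j. \<bar>u i j\<bar> \<le> 2 * l" and pq: "trapezoidal_pair p q"
  defines "w \<equiv> \<lambda>i j. q (r i j) - ((u i j)\<^sup>2 + (v i j)\<^sup>2) / 2"
    and "m \<equiv> \<lambda>i j. r i j * u i j" and "n \<equiv> \<lambda>i j. r i j * v i j"
  shows "0 \<le> gsum N (\<lambda>i j.
      w i j * (dxc N m i j - l * mesh N * lapx N r i j)
    + u i j * (dxc N (\<lambda>i j. r i j * (u i j)\<^sup>2) i j + dxc N (\<lambda>i j. p (r i j)) i j
        - l * mesh N * lapx N m i j)
    + v i j * (dxc N (\<lambda>i j. r i j * u i j * v i j) i j - l * mesh N * lapx N n i j))"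
    (is "0 \<le> ?A")
proof -
  let ?h = "mesh N"
  have h: "?h > 0" using N by (simp add: mesh_def)
  note P = per[unfolded periodic_grid_def, rule_format]
  have pers: "periodic_grid N w" "periodic_grid N m" "periodic_grid N n"
    "periodic_grid N (\<lambda>i j. r i j * (u i j)\<^sup>2)" "periodic_grid N (\<lambda>i j. p (r i j))"
    "periodic_grid N (\<lambda>i j. r i j * u i j * v i j)" "periodic_grid N (\<lambda>i j. p (r i j) * u i j)"
    unfolding periodic_grid_def w_def m_def n_def by (simp_all add: P)
  define d :: "grid \<Rightarrow> grid" where "d f i j = f (i + 1) j - f i j" for f i j
  define s :: "grid \<Rightarrow> grid" where "s f i j = (f i j + f (i + 1) j) / 2" for f i j
  have C: "gsum N (\<lambda>i j. a i j * dxc N f i j) = - (1 / ?h) * gsum N (\<lambda>i j. d a i j * s f i j)"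
    if "periodic_grid N a" "periodic_grid N f" for a f
    using gsum_mult_dxc[OF that] by (simp add: d_def s_def)
  have Lx: "gsum N (\<lambda>i j. a i j * lapx N f i j) = - (1 / ?h\<^sup>2) * gsum N (\<lambda>i j. d a i j * d f i j)"
    if "periodic_grid N a" "periodic_grid N f" for a f
  proof -
    have "gsum N (\<lambda>i j. dxp N a i j * dxp N f i j) = gsum N (\<lambda>i j. 1 / ?h\<^sup>2 * (d a i j * d f i j))"
      by (simp add: dxp_def d_def power2_eq_square)
    then show ?thesis by (simp only: gsum_mult_lapx[OF that] gsum_cmult)
  qed
  \<comment> \<open>The flux potential telescopes, so it can be added to the edge terms at no
    cost.\<close>
  have tele: "gsum N (d (\<lambda>i j. p (r i j) * u i j)) = 0"
    using gsum_shift_x[OF pers(7)]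
      gsum_diff[of N "\<lambda>i j. p (r (i + 1) j) * u (i + 1) j" "\<lambda>i j. p (r i j) * u i j"]
    by (simp add: d_def[abs_def])
  \<comment> \<open>Right-hand side minus left-hand side of the edge inequality for the edge from i
    to i + 1.\<close>
  define D where "D i j =
      l * (d w i j * d r i j + d u i j * d m i j + d v i j * d n i j)
      - (d w i j * s m i j + d u i j * s (\<lambda>i j. r i j * (u i j)\<^sup>2) i j
        + d u i j * s (\<lambda>i j. p (r i j)) i j + d v i j * s (\<lambda>i j. r i j * u i j * v i j) i j
        - d (\<lambda>i j. p (r i j) * u i j) i j)" for i j
  have "?A = gsum N (\<lambda>i j. w i j * dxc N m i j - l * ?h * (w i j * lapx N r i j)
      + (u i j * dxc N (\<lambda>i j. r i j * (u i j)\<^sup>2) i j + u i j * dxc N (\<lambda>i j. p (r i j)) i j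
        - l * ?h * (u i j * lapx N m i j))
      + (v i j * dxc N (\<lambda>i j. r i j * u i j * v i j) i j - l * ?h * (v i j * lapx N n i j)))"
    by (simp add: algebra_simps)
  \<comment> \<open>The central differences carry 1/h and the numerical diffusion l h / h^2, hence
    the common factor.\<close>
  also have "\<dots> = 1 / ?h * gsum N D"
    unfolding D_def
    by (simp only: gsum_add gsum_diff gsum_cmult C Lx per pers tele)
      (use h in \<open>simp add: field_simps power2_eq_square\<close>)
  finally have A: "?A = 1 / ?h * gsum N D" .
  have "0 \<le> D i j" for i j
    using edge_entropy_production[of "r i j" "r (i + 1) j" "u i j" l "u (i + 1) j"
        "q (r (i + 1) j)" "q (r i j)" "p (r (i + 1) j)" "p (r i j)" "v (i + 1) j" "v i j"]
      pos u pq
    unfolding D_def d_def s_def w_def m_def n_def trapezoidal_pair_def by simp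
  then show ?thesis unfolding A using h gsum_nonneg[of D] by simp
qed

text \<open>Exchanging the coordinates together with the two velocity components maps this to
  \<open>flux_dissipation_x\<close>; \<open>w\<close> is symmetric in the components.\<close>

lemma flux_dissipation_y:
  assumes N: "N \<ge> 1" and per: "periodic_grid N r" "periodic_grid N u" "periodic_grid N v"
    and pos: "\<And>i j. r i j > 0" and v: "\<And>i j. \<bar>v i j\<bar> \<le> 2 * l" and pq: "trapezoidal_pair p q"
  defines "w \<equiv> \<lambda>i j. q (r i j) - ((u i j)\<^sup>2 + (v i j)\<^sup>2) / 2"
    and "m \<equiv> \<lambda>i j. r i j * u i j" and "n \<equiv> \<lambda>i j. r i j * v i j"
  shows "0 \<le> gsum N (\<lambda>i j.
      w i j * (dyc N n i j - l * mesh N * lapx N (\<lambda>i j. r j i) j i)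
    + u i j * (dyc N (\<lambda>i j. r i j * u i j * v i j) i j - l * mesh N * lapx N (\<lambda>i j. m j i) j i)
    + v i j * (dyc N (\<lambda>i j. r i j * (v i j)\<^sup>2) i j + dyc N (\<lambda>i j. p (r i j)) i j
        - l * mesh N * lapx N (\<lambda>i j. n j i) j i))"
    (is "0 \<le> gsum N ?f")
proof -
  note t = periodic_grid_transpose
  have "0 \<le> gsum N (\<lambda>i j. ?f j i)"
    using flux_dissipation_x[OF N t[OF per(1)] t[OF per(3)] t[OF per(2)] pos v pq]
    by (simp add: dyc_eq_dxc w_def m_def n_def algebra_simps)
  also have "\<dots> = gsum N ?f" by (rule gsum_transpose)
  finally show ?thesis .
qed

subsection \<open>The energy balance\<close>

lemma periodic_grid_dxc: "periodic_grid N f \<Longrightarrow> periodic_grid N (dxc N f)"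
  using periodic_grid_shift[of N f 1 0] periodic_grid_shift[of N f "-1" 0]
  by (simp add: periodic_grid_def dxc_def)

lemma periodic_grid_dyc: "periodic_grid N f \<Longrightarrow> periodic_grid N (dyc N f)"
  using periodic_grid_shift[of N f 0 1] periodic_grid_shift[of N f 0 "-1"]
  by (simp add: periodic_grid_def dyc_def)

lemma periodic_grid_mass_op:
  assumes "periodic_grid N r" "periodic_grid N m" "periodic_grid N n"
  shows "periodic_grid N (mass_op N l r m n)"
  unfolding periodic_grid_def mass_op_def
  by (simp only: periodic_gridD[OF periodic_grid_dxc[OF assms(2)]]
      periodic_gridD[OF periodic_grid_dyc[OF assms(3)]]
      periodic_gridD[OF periodic_grid_lap[OF assms(1)]]) simp

lemma norm_gradp_squared: "(norm (gradp N f i j))\<^sup>2 = (dxp N f i j)\<^sup>2 + (dyp N f i j)\<^sup>2"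
  by (simp add: gradp_def norm_Pair)

text \<open>The sound speed is nonnegative, so twice the parameter dominates the norm of the
  velocity and hence each component; a representative cell extends the bound to all indices.\<close>

lemma vel_le_dissipation_parameter:
  assumes "N \<ge> 1" "pressure_function p"
    and per: "periodic_grid N r" "periodic_grid N m" "periodic_grid N n"
    and pos: "\<And>i j. r i j > 0"
  shows "\<bar>vel r m i j\<bar> \<le> 2 * dissipation_parameter N p r m n"
    and "\<bar>vel r n i j\<bar> \<le> 2 * dissipation_parameter N p r m n"
proof -
  let ?s = "\<lambda>i j. norm (vel r m i j, vel r n i j) + sqrt (deriv p (r i j))"
  obtain i' j' where c: "(i', j') \<in> cells N" "\<And>g. periodic_grid N g \<Longrightarrow> g i j = g i' j'"
    using periodic_grid_cell[OF assms(1), of i j] by blast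
  have "finite (cells N)" by (simp add: cells_def)
  then have "?s i' j' \<le> 2 * dissipation_parameter N p r m n"
    using c(1) by (auto simp: dissipation_parameter_def intro!: Max_ge intro: rev_image_eqI)
  moreover have "?s i j = ?s i' j'"
    using c(2)[of r] c(2)[of "vel r m"] c(2)[of "vel r n"] per
    by (simp add: periodic_grid_vel)
  moreover have "0 \<le> sqrt (deriv p (r i j))"
    using assms(2) pos[of i j] by (simp add: pressure_function_def less_imp_le)
  ultimately have "norm (vel r m i j, vel r n i j) \<le> 2 * dissipation_parameter N p r m n"
    by linarith
  then show "\<bar>vel r m i j\<bar> \<le> 2 * dissipation_parameter N p r m n"
    and "\<bar>vel r n i j\<bar> \<le> 2 * dissipation_parameter N p r m n"
    using norm_fst_le[of "vel r m i j" "vel r n i j"] norm_snd_le[of "vel r n i j" "vel r m i j"]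
    by simp_all
qed

text \<open>The kinetic energy is (m^2 + n^2) / (2 rho), whose partial derivatives are -(u^2 + v^2)
  / 2, \<open>u\<close> and \<open>v\<close>. The rates \<open>R\<close>, \<open>M\<close>,
  \<open>K\<close> are arbitrary, which separates the chain rule from the scheme; the capillary part
  is not yet summed by parts.\<close>

lemma energy_has_derivative:
  assumes P: "P differentiable_on {0<..}" and pos: "\<And>i j. \<rho> t i j > 0"
    and D: "\<And>i j. ((\<lambda>s. \<rho> s i j) has_real_derivative R i j) (at t within I)"
      "\<And>i j. ((\<lambda>s. m s i j) has_real_derivative M i j) (at t within I)"
      "\<And>i j. ((\<lambda>s. n s i j) has_real_derivative K i j) (at t within I)"
  defines "u \<equiv> vel (\<rho> t) (m t)" and "v \<equiv> vel (\<rho> t) (n t)"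
  shows "((\<lambda>s. energy N P \<kappa> (\<rho> s) (m s) (n s)) has_real_derivative
      1 / (real N)\<^sup>2 * gsum N (\<lambda>i j.
        (deriv P (\<rho> t i j) - ((u i j)\<^sup>2 + (v i j)\<^sup>2) / 2) * R i j + u i j * M i j + v i j * K i j
        + \<kappa> * (dxp N R i j * dxp N (\<rho> t) i j + dyp N R i j * dyp N (\<rho> t) i j)))
    (at t within I)"
proof -
  have "((\<lambda>s. cell_energy N P \<kappa> (\<rho> s) (m s) (n s) i j) has_real_derivative
      (deriv P (\<rho> t i j) - ((u i j)\<^sup>2 + (v i j)\<^sup>2) / 2) * R i j + u i j * M i j + v i j * K i j
        + \<kappa> * (dxp N R i j * dxp N (\<rho> t) i j + dyp N R i j * dyp N (\<rho> t) i j))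
    (at t within I)" for i j
  proof -
    have nz: "\<rho> t i j \<noteq> 0" using pos[of i j] by simp
    have U: "((\<lambda>s. vel (\<rho> s) (m s) i j) has_real_derivative (M i j - u i j * R i j) / \<rho> t i j)
        (at t within I)"
      unfolding vel_def u_def
      by (rule derivative_eq_intros D nz refl)+ (use nz in \<open>simp add: field_simps\<close>)
    have W: "((\<lambda>s. vel (\<rho> s) (n s) i j) has_real_derivative (K i j - v i j * R i j) / \<rho> t i j)
        (at t within I)"
      unfolding vel_def v_def
      by (rule derivative_eq_intros D nz refl)+ (use nz in \<open>simp add: field_simps\<close>)
    have G: "((\<lambda>s. dxp N (\<rho> s) i j) has_real_derivative dxp N R i j) (at t within I)"
      "((\<lambda>s. dyp N (\<rho> s) i j) has_real_derivative dyp N R i j) (at t within I)"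
      unfolding dxp_def dyp_def by (rule DERIV_cdivide DERIV_diff D)+
    have Q: "((\<lambda>s. P (\<rho> s i j)) has_real_derivative deriv P (\<rho> t i j) * R i j) (at t within I)"
      by (rule DERIV_chain2[OF deriv_within_pos[OF P pos] D(1)])
    have "((\<lambda>s. 1 / 2 * \<rho> s i j * ((vel (\<rho> s) (m s) i j)\<^sup>2 + (vel (\<rho> s) (n s) i j)\<^sup>2)
        + P (\<rho> s i j) + \<kappa> / 2 * ((dxp N (\<rho> s) i j)\<^sup>2 + (dyp N (\<rho> s) i j)\<^sup>2))
      has_real_derivative
        1 / 2 * R i j * ((u i j)\<^sup>2 + (v i j)\<^sup>2) + 1 / 2 * \<rho> t i j *
          (2 * u i j * ((M i j - u i j * R i j) / \<rho> t i j)
            + 2 * v i j * ((K i j - v i j * R i j) / \<rho> t i j))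
        + deriv P (\<rho> t i j) * R i j
        + \<kappa> / 2 * (2 * dxp N (\<rho> t) i j * dxp N R i j + 2 * dyp N (\<rho> t) i j * dyp N R i j))
      (at t within I)"
      by (rule derivative_eq_intros D U W G Q refl)+ (simp add: u_def v_def algebra_simps)
    moreover have "(\<lambda>s. 1 / 2 * \<rho> s i j * ((vel (\<rho> s) (m s) i j)\<^sup>2 + (vel (\<rho> s) (n s) i j)\<^sup>2)
        + P (\<rho> s i j) + \<kappa> / 2 * ((dxp N (\<rho> s) i j)\<^sup>2 + (dyp N (\<rho> s) i j)\<^sup>2))
      = (\<lambda>s. cell_energy N P \<kappa> (\<rho> s) (m s) (n s) i j)"
      by (simp add: cell_energy_def norm_gradp_squared norm_Pair)
    moreover have "1 / 2 * R i j * ((u i j)\<^sup>2 + (v i j)\<^sup>2) + 1 / 2 * \<rho> t i j *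
          (2 * u i j * ((M i j - u i j * R i j) / \<rho> t i j)
            + 2 * v i j * ((K i j - v i j * R i j) / \<rho> t i j))
        + deriv P (\<rho> t i j) * R i j
        + \<kappa> / 2 * (2 * dxp N (\<rho> t) i j * dxp N R i j + 2 * dyp N (\<rho> t) i j * dyp N R i j)
      = (deriv P (\<rho> t i j) - ((u i j)\<^sup>2 + (v i j)\<^sup>2) / 2) * R i j + u i j * M i j + v i j * K i j
        + \<kappa> * (dxp N R i j * dxp N (\<rho> t) i j + dyp N R i j * dyp N (\<rho> t) i j)"
      using nz by (simp add: field_simps power2_eq_square)
    ultimately show ?thesis by simp
  qed
  then show ?thesis
    unfolding energy_def gsum_iterated cells_def sum.cartesian_product[symmetric]
    by (intro DERIV_cmult DERIV_sum)
qed

text \<open>Purely spatial part of the balance: the transport parts of \<open>kort\<close> and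
  \<open>cap\<close> cancel, and the nonnegative sums of \<open>X\<close> and \<open>Y\<close> are
  discarded.\<close>

lemma energy_production_le:
  assumes N: "N \<ge> 1" and per: "periodic_grid N r" "periodic_grid N m" "periodic_grid N n"
    and pos: "\<And>i j. r i j > 0" and pq: "trapezoidal_pair p q"
    and vel: "\<And>i j. \<bar>vel r m i j\<bar> \<le> 2 * l" "\<And>i j. \<bar>vel r n i j\<bar> \<le> 2 * l"
  defines "u \<equiv> vel r m" and "v \<equiv> vel r n"
    and "R \<equiv> \<lambda>i j. - mass_op N l r m n i j"
  shows "gsum N (\<lambda>i j. (q (r i j) - ((u i j)\<^sup>2 + (v i j)\<^sup>2) / 2) * R i j
        + u i j * - momentum_x_op N p \<mu> \<kappa> l r m n i j + v i j * - momentum_y_op N p \<mu> \<kappa> l r m n i j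
        + \<kappa> * (dxp N R i j * dxp N r i j + dyp N R i j * dyp N r i j))
    \<le> - \<mu> * gsum N (\<lambda>i j. (norm (gradp N u i j))\<^sup>2 + (norm (gradp N v i j))\<^sup>2)
      - \<kappa> * gsum N (\<lambda>i j. l * mesh N * (lap N r i j)\<^sup>2)"
    (is "?E \<le> _")
proof -
  have mn: "m = (\<lambda>i j. r i j * u i j)" "n = (\<lambda>i j. r i j * v i j)"
    using pos by (auto simp: fun_eq_iff u_def v_def vel_def less_imp_neq[THEN not_sym])
  have pu: "periodic_grid N u" "periodic_grid N v"
    unfolding u_def v_def by (intro periodic_grid_vel per)+
  have pR: "periodic_grid N R"
    using periodic_grid_comp[OF periodic_grid_mass_op[OF per], of uminus] by (simp add: R_def)
  have pl: "periodic_grid N (lap N r)" by (rule periodic_grid_lap[OF per(1)])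
  define w where "w i j = q (r i j) - ((u i j)\<^sup>2 + (v i j)\<^sup>2) / 2" for i j
  \<comment> \<open>\<open>X\<close> and \<open>Y\<close> collect the Euler flux and the numerical
    diffusion of each direction, tested with the entropy variables.\<close>
  define X where "X i j = w i j * (dxc N m i j - l * mesh N * lapx N r i j)
    + u i j * (dxc N (\<lambda>i j. r i j * (u i j)\<^sup>2) i j + dxc N (\<lambda>i j. p (r i j)) i j
        - l * mesh N * lapx N m i j)
    + v i j * (dxc N (\<lambda>i j. r i j * u i j * v i j) i j - l * mesh N * lapx N n i j)" for i j
  define Y where "Y i j = w i j * (dyc N n i j - l * mesh N * lapx N (\<lambda>i j. r j i) j i)
    + u i j * (dyc N (\<lambda>i j. r i j * u i j * v i j) i j - l * mesh N * lapx N (\<lambda>i j. m j i) j i)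
    + v i j * (dyc N (\<lambda>i j. r i j * (v i j)\<^sup>2) i j + dyc N (\<lambda>i j. p (r i j)) i j
        - l * mesh N * lapx N (\<lambda>i j. n j i) j i)" for i j
  have XY: "0 \<le> gsum N X" "0 \<le> gsum N Y"
    using flux_dissipation_x[OF N per(1) pu pos vel(1)[folded u_def] pq]
      flux_dissipation_y[OF N per(1) pu pos vel(2)[folded v_def] pq]
    unfolding X_def Y_def w_def mn by simp_all
  have point: "w i j * R i j
        + u i j * - momentum_x_op N p \<mu> \<kappa> l r m n i j + v i j * - momentum_y_op N p \<mu> \<kappa> l r m n i j
      = \<mu> * (u i j * lap N u i j + v i j * lap N v i j)
        + \<kappa> * (m i j * dxc N (lap N r) i j + n i j * dyc N (lap N r) i j) - X i j - Y i j" for i j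
  proof -
    have m: "m i j = r i j * u i j" "n i j = r i j * v i j" by (simp_all add: mn)
    show ?thesis
      unfolding X_def Y_def R_def mass_op_def momentum_x_op_def momentum_y_op_def
        u_def[symmetric] v_def[symmetric] korteweg_x_eq korteweg_y_eq m
        lap_eq_lapx[of N r] lap_eq_lapx[of N m] lap_eq_lapx[of N n]
      by (simp add: algebra_simps)
  qed
  have visc: "gsum N (\<lambda>i j. u i j * lap N u i j + v i j * lap N v i j)
      = - gsum N (\<lambda>i j. (norm (gradp N u i j))\<^sup>2 + (norm (gradp N v i j))\<^sup>2)"
    unfolding norm_gradp_squared by (simp add: gsum_add gsum_mult_lap pu power2_eq_square)
  have kort: "gsum N (\<lambda>i j. m i j * dxc N (lap N r) i j + n i j * dyc N (lap N r) i j)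
      = - gsum N (\<lambda>i j. lap N r i j * dxc N m i j + lap N r i j * dyc N n i j)"
    by (simp only: gsum_add gsum_dxc_by_parts[OF per(2) pl] gsum_dyc_by_parts[OF per(3) pl])
  \<comment> \<open>Moving the differences off \<open>R\<close> tests the mass equation with
    \<open>lap N r\<close>: transport gives the counterpart of \<open>kort\<close>, numerical
    diffusion the capillary dissipation.\<close>
  have "gsum N (\<lambda>i j. dxp N R i j * dxp N r i j + dyp N R i j * dyp N r i j)
      = - gsum N (\<lambda>i j. R i j * lap N r i j)"
    using gsum_mult_lap[OF pR per(1)] by simp
  also have "\<dots> = - gsum N (\<lambda>i j. l * mesh N * (lap N r i j)\<^sup>2
      - (lap N r i j * dxc N m i j + lap N r i j * dyc N n i j))"
    by (simp add: R_def mass_op_def algebra_simps power2_eq_square)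
  finally have cap: "gsum N (\<lambda>i j. dxp N R i j * dxp N r i j + dyp N R i j * dyp N r i j)
      = gsum N (\<lambda>i j. lap N r i j * dxc N m i j + lap N r i j * dyc N n i j)
        - gsum N (\<lambda>i j. l * mesh N * (lap N r i j)\<^sup>2)"
    by (simp only: gsum_diff)
  have "?E = \<mu> * gsum N (\<lambda>i j. u i j * lap N u i j + v i j * lap N v i j)
      + \<kappa> * gsum N (\<lambda>i j. m i j * dxc N (lap N r) i j + n i j * dyc N (lap N r) i j)
      - gsum N X - gsum N Y
      + \<kappa> * gsum N (\<lambda>i j. dxp N R i j * dxp N r i j + dyp N R i j * dyp N r i j)"
  proof -
    have add: "gsum N (\<lambda>i j. a i j + \<kappa> * b i j) = gsum N a + \<kappa> * gsum N b" for a b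
      by (simp only: gsum_add gsum_cmult)
    have lin: "gsum N (\<lambda>i j. \<mu> * a i j + \<kappa> * b i j - X i j - Y i j)
        = \<mu> * gsum N a + \<kappa> * gsum N b - gsum N X - gsum N Y" for a b
      by (simp only: gsum_add gsum_diff gsum_cmult)
    show ?thesis
      unfolding w_def[symmetric] point add lin ..
  qed
  also have "\<dots> = - \<mu> * gsum N (\<lambda>i j. (norm (gradp N u i j))\<^sup>2 + (norm (gradp N v i j))\<^sup>2)
      - \<kappa> * gsum N (\<lambda>i j. l * mesh N * (lap N r i j)\<^sup>2) - gsum N X - gsum N Y"
    unfolding visc kort cap by (simp add: algebra_simps)
  finally show ?thesis using XY by linarith
qed

text \<open>The derivative within \<open>I\<close> is two-sided at every point strictly between s
  and t, where the mean value argument needs it; at s and t, possibly endpoints of \<open>I\<close>,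
  continuity suffices.\<close>

lemma antimono_on_interval_if_deriv_nonpos:
  fixes f :: "real \<Rightarrow> real"
  assumes "is_interval I"
    and D: "\<And>t. t \<in> I \<Longrightarrow> \<exists>d. (f has_real_derivative d) (at t within I) \<and> d \<le> 0"
  shows "antimono_on I f"
proof (rule monotone_onI)
  fix s t assume st: "s \<in> I" "t \<in> I" "s \<le> t"
  have sub: "{s..t} \<subseteq> I"
    using mem_is_interval_1_I[OF assms(1) st(1,2)] by auto
  have "continuous_on I f"
    using D by (meson DERIV_continuous continuous_on_eq_continuous_within)
  then have cont: "continuous_on {s..t} f"
    using sub by (rule continuous_on_subset)
  show "f t \<le> f s"
  proof (rule DERIV_nonpos_imp_decreasing_open[OF st(3) _ cont])
    fix x assume x: "s < x" "x < t"
    obtain d where d: "(f has_real_derivative d) (at x within I)" "d \<le> 0"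
      using D[OF subsetD[OF sub, of x]] x by auto
    have "(f has_real_derivative d) (at x within {s<..<t})"
      using d(1) by (rule DERIV_subset) (use sub greaterThanLessThan_subseteq_atLeastAtMost_iff in blast)
    then show "\<exists>y. (f has_real_derivative y) (at x) \<and> y \<le> 0"
      using d(2) x by (auto simp: at_within_open[of x "{s<..<t}"])
  qed
qed

section \<open>Energy dissipation along a solution, from the chain rule and the spatial
  estimate\<close>

theorem theorem5:
  fixes N :: nat and \<mu> \<kappa> :: real and p P :: "real \<Rightarrow> real"
    and I :: "real set" and lam :: "real \<Rightarrow> real"
    and \<rho> m n :: "real \<Rightarrow> grid"
  assumes "N \<ge> 1" and "\<mu> \<ge> 0" and "\<kappa> > 0"
    and "pressure_function p" and "potential_energy p P"
    and "is_interval I" and "interior I \<noteq> {}"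
    and "\<And>t. t \<in> I \<Longrightarrow> lam t = dissipation_parameter N p (\<rho> t) (m t) (n t)"
    and "nsk_solution N p \<mu> \<kappa> lam I \<rho> m n"
  shows "antimono_on I (\<lambda>t. energy N P \<kappa> (\<rho> t) (m t) (n t)) \<and>
    (\<forall>t\<in>I.
       let u = vel (\<rho> t) (m t); v = vel (\<rho> t) (n t);
           B = - \<mu> * (1 / (real N)\<^sup>2 *
                  (\<Sum>(i, j)\<in>cells N. (norm (gradp N u i j))\<^sup>2 + (norm (gradp N v i j))\<^sup>2))
               - \<kappa> * (1 / (real N)\<^sup>2 *
                  (\<Sum>(i, j)\<in>cells N. lam t * mesh N * (lap N (\<rho> t) i j)\<^sup>2))
       in \<exists>E'. ((\<lambda>s. energy N P \<kappa> (\<rho> s) (m s) (n s)) has_real_derivative E') (at t within I)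
              \<and> E' \<le> B \<and> B \<le> 0)"
proof -
  let ?e = "\<lambda>t. energy N P \<kappa> (\<rho> t) (m t) (n t)"
  define G where "G t = gsum N (\<lambda>i j. (norm (gradp N (vel (\<rho> t) (m t)) i j))\<^sup>2
      + (norm (gradp N (vel (\<rho> t) (n t)) i j))\<^sup>2)" for t
  define C where "C t = gsum N (\<lambda>i j. lam t * mesh N * (lap N (\<rho> t) i j)\<^sup>2)" for t
  \<comment> \<open>Both sums are weighted with the cell area 1/N^2, as the energy is.\<close>
  define B where "B t = - \<mu> * (1 / (real N)\<^sup>2 * G t) - \<kappa> * (1 / (real N)\<^sup>2 * C t)" for t
  have main: "\<exists>E'. (?e has_real_derivative E') (at t within I) \<and> E' \<le> B t \<and> B t \<le> 0"
    if t: "t \<in> I" for t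
  proof -
    have per: "periodic_grid N (\<rho> t)" "periodic_grid N (m t)" "periodic_grid N (n t)"
      and pos: "\<rho> t i j > 0"
      and D: "((\<lambda>s. \<rho> s i j) has_real_derivative
              - mass_op N (lam t) (\<rho> t) (m t) (n t) i j) (at t within I)"
           "((\<lambda>s. m s i j) has_real_derivative
              - momentum_x_op N p \<mu> \<kappa> (lam t) (\<rho> t) (m t) (n t) i j) (at t within I)"
           "((\<lambda>s. n s i j) has_real_derivative
              - momentum_y_op N p \<mu> \<kappa> (lam t) (\<rho> t) (m t) (n t) i j) (at t within I)" for i j
      using assms(9) t unfolding nsk_solution_def by blast+
    have vel: "\<bar>vel (\<rho> t) (m t) i j\<bar> \<le> 2 * lam t" "\<bar>vel (\<rho> t) (n t) i j\<bar> \<le> 2 * lam t" for i j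
      using vel_le_dissipation_parameter[OF assms(1,4) per pos] assms(8)[OF t] by simp_all
    \<comment> \<open>Twice the parameter bounds an absolute value; any index would do.\<close>
    have "0 \<le> lam t" using vel(1)[of 0 0] by linarith
    then have "0 \<le> C t" "0 \<le> G t"
      by (auto simp: C_def G_def mesh_def intro!: gsum_nonneg)
    then have "0 \<le> \<mu> * (1 / (real N)\<^sup>2 * G t)" "0 \<le> \<kappa> * (1 / (real N)\<^sup>2 * C t)"
      using assms(2,3) by simp_all
    then have "B t \<le> 0" unfolding B_def by linarith
    moreover have "P differentiable_on {0<..}"
      using assms(5) by (simp add: potential_energy_def)
    note energy_has_derivative[OF this pos D, of N \<kappa>]
    moreover note mult_left_mono[OF energy_production_le[OF assms(1) per pos
      trapezoidal_pair_deriv_potential[OF assms(4,5)] vel, of \<mu> \<kappa>], of "1 / (real N)\<^sup>2"]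
    ultimately show ?thesis
      unfolding B_def G_def C_def
      by (intro exI conjI) (assumption, simp_all add: algebra_simps)
  qed
  have "\<exists>d. (?e has_real_derivative d) (at t within I) \<and> d \<le> 0" if "t \<in> I" for t
    using main[OF that] by (blast intro: order_trans)
  then have "antimono_on I ?e"
    by (rule antimono_on_interval_if_deriv_nonpos[OF assms(6)])
  then show ?thesis
    using main unfolding Let_def B_def G_def C_def gsum_def by blast
qed

end
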